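(* Let $R$ be a ring, let $A$ be a commutative associative unital $R$-algebra, let $\sigma,\tau : A\to A$ be algebra morphisms and let $\Delta$ be a $(\tau,\sigma)$-derivation of $A$. Suppose that, with some $\delta\in A$, for all $a \in A$ $$\sigma(\tau(a)) = \tau(\sigma(a)), \qquad \Delta(\sigma(a)) = \delta\, \sigma(\Delta(a)), \qquad \Delta(\tau(a)) = \delta\, \tau(\Delta(a)).$$ Then the bracket $[\cdot,\cdot]'_{\tau,\sigma} : A \cdot \Delta \times A \cdot \Delta \to A \cdot \Delta$ defined for $a,b \in A$ by $$[a \cdot \Delta,b \cdot \Delta]'_{\tau,\sigma} = (\sigma(a)\Delta(b)-\sigma(b)\Delta(a)) \cdot \Delta$$ endows $(A \cdot \Delta,[\cdot,\cdot]'_{\tau,\sigma},\overline{\sigma + \tau})$ with a structure of Hom-Lie algebra, where $\overline{\sigma+\tau}(a\cdot\Delta) = (\sigma(a)+\tau(a))\cdot\Delta$.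
   Context: A $(\tau,\sigma)$-derivation of $A$ is an $R$-linear map $D : A \to A$ with $D(ab)=D(a)\tau(b)+\sigma(a)D(b)$ for all $a,b\in A$. For $a\in A$, $a\cdot \Delta$ is the map $x \mapsto a\Delta(x)$, and $A\cdot\Delta = \{a\cdot\Delta : a\in A\}$. A map $\alpha : A\to A$ is extended to $A\cdot\Delta$ by $\overline{\alpha}(a\cdot\Delta)=\alpha(a)\cdot\Delta$. A Hom-Lie algebra over $R$ is a triple $(L,[\cdot,\cdot],\alpha)$ with $L$ an $R$-linear space, $[\cdot,\cdot]:L\times L\to L$ an $R$-bilinear skew-symmetric bracket and $\alpha:L\to L$ a linear map (the twist) such that $[\alpha(x),[y,z]]+[\alpha(y),[z,x]]+[\alpha(z),[x,y]]=0$ for all $x,y,z\in L$ (Hom-Jacobi identity).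
   Formalization: The bracket and twist are assumed to be well-defined maps on A·Δ satisfying the displayed formulas; this can fail under the stated hypotheses, since a·Δ need not determine a (e.g. A = k×k, τ = id, σ(a) = (a₁,a₁), Δ = τ − σ, δ = 1). R is taken commutative. *)

theory Defs
  imports "HOL-Algebra.Module" "HOL-Library.FuncSet"
begin

definition linear_map ::
  "('r, 'k) ring_scheme \<Rightarrow> ('r, 'a, 'm) module_scheme \<Rightarrow> ('r, 'b, 'n) module_scheme \<Rightarrow> ('a \<Rightarrow> 'b) \<Rightarrow> bool"
  where "linear_map R M N f \<longleftrightarrow>
    f \<in> carrier M \<rightarrow> carrier N \<and>
    (\<forall>x\<in>carrier M. \<forall>y\<in>carrier M. f (x \<oplus>\<^bsub>M\<^esub> y) = f x \<oplus>\<^bsub>N\<^esub> f y) \<and>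
    (\<forall>r\<in>carrier R. \<forall>x\<in>carrier M. f (r \<odot>\<^bsub>M\<^esub> x) = r \<odot>\<^bsub>N\<^esub> f x)"

definition algebra_morphism ::
  "('r, 'k) ring_scheme \<Rightarrow> ('r, 'a, 'm) module_scheme \<Rightarrow> ('r, 'b, 'n) module_scheme \<Rightarrow> ('a \<Rightarrow> 'b) \<Rightarrow> bool"
  where "algebra_morphism R A B f \<longleftrightarrow> f \<in> ring_hom A B \<and> linear_map R A B f"

definition twisted_derivation ::
  "('r, 'k) ring_scheme \<Rightarrow> ('r, 'a, 'm) module_scheme \<Rightarrow> ('a \<Rightarrow> 'a) \<Rightarrow> ('a \<Rightarrow> 'a) \<Rightarrow> ('a \<Rightarrow> 'a) \<Rightarrow> bool"
  where "twisted_derivation R A \<tau> \<sigma> D \<longleftrightarrow>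
    linear_map R A A D \<and>
    (\<forall>a\<in>carrier A. \<forall>b\<in>carrier A.
      D (a \<otimes>\<^bsub>A\<^esub> b) = D a \<otimes>\<^bsub>A\<^esub> \<tau> b \<oplus>\<^bsub>A\<^esub> \<sigma> a \<otimes>\<^bsub>A\<^esub> D b)"

(* The map x |-> a D(x). Maps out of A are made extensional (undefined outside
   the carrier), so that HOL equality is equality of maps on A. *)
definition left_mult_map :: "('r, 'a, 'm) module_scheme \<Rightarrow> ('a \<Rightarrow> 'a) \<Rightarrow> 'a \<Rightarrow> ('a \<Rightarrow> 'a)"
  where "left_mult_map A D a = (\<lambda>x\<in>carrier A. a \<otimes>\<^bsub>A\<^esub> D x)"

(* All maps A -> A with pointwise operations. *)
definition maps_module :: "('r, 'a, 'm) module_scheme \<Rightarrow> ('r, 'a \<Rightarrow> 'a) module"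
  where "maps_module A =
    \<lparr>carrier = carrier A \<rightarrow>\<^sub>E carrier A,
     mult = (\<lambda>f g. \<lambda>x\<in>carrier A. f x \<otimes>\<^bsub>A\<^esub> g x),
     one = (\<lambda>x\<in>carrier A. \<one>\<^bsub>A\<^esub>),
     zero = (\<lambda>x\<in>carrier A. \<zero>\<^bsub>A\<^esub>),
     add = (\<lambda>f g. \<lambda>x\<in>carrier A. f x \<oplus>\<^bsub>A\<^esub> g x),
     smult = (\<lambda>r f. \<lambda>x\<in>carrier A. r \<odot>\<^bsub>A\<^esub> f x)\<rparr>"

(* The set {a . D | a in A} of maps, with its pointwise R-linear structure; the
   ring multiplication inherited by the record from maps_module is irrelevant.
   Since a . D is a map, it need not determine a. *)
definition left_mult_module :: "('r, 'a, 'm) module_scheme \<Rightarrow> ('a \<Rightarrow> 'a) \<Rightarrow> ('r, 'a \<Rightarrow> 'a) module"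
  where "left_mult_module A D = (maps_module A)\<lparr>carrier := left_mult_map A D ` carrier A\<rparr>"

locale hom_lie_algebra = module R L for R (structure) and L (structure) +
  fixes bracket :: "'c \<Rightarrow> 'c \<Rightarrow> 'c" and twist :: "'c \<Rightarrow> 'c"
  assumes bracket_linear_left: "y \<in> carrier L \<Longrightarrow> linear_map R L L (\<lambda>x. bracket x y)"
    and bracket_linear_right: "x \<in> carrier L \<Longrightarrow> linear_map R L L (\<lambda>y. bracket x y)"
    and bracket_skew:
      "\<lbrakk>x \<in> carrier L; y \<in> carrier L\<rbrakk> \<Longrightarrow> bracket x y = \<ominus>\<^bsub>L\<^esub> bracket y x"
    and twist_linear: "linear_map R L L twist"
    and hom_jacobi:
      "\<lbrakk>x \<in> carrier L; y \<in> carrier L; z \<in> carrier L\<rbrakk> \<Longrightarrow>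
        bracket (twist x) (bracket y z) \<oplus>\<^bsub>L\<^esub> bracket (twist y) (bracket z x)
          \<oplus>\<^bsub>L\<^esub> bracket (twist z) (bracket x y) = \<zero>\<^bsub>L\<^esub>"

end

(* The bracket is the image, under the surjection a |-> a . Delta, of the bracket
   br a b = sigma(a) Delta(b) - sigma(b) Delta(a) on A itself, so it suffices to verify
   the axioms in A.  For the Hom-Jacobi identity, Delta(br b c) is expanded by the twisted
   Leibniz rule in two ways, according to the order of the commuting factors.  One expansion
   is used where Delta(br b c) is multiplied by sigma(sigma(a)), the other where it is
   multiplied by sigma(tau(a)); then everything cancels in the cyclic sum. *)

theory Submission
  imports Defs
begin

text \<open>Every element of \<open>N\<close> is an image under \<open>f\<close>, so each module
  axiom, closure included, can be checked on preimages in \<open>M\<close>; negatives are images of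
  negatives. Injectivity of \<open>f\<close> is not assumed, which matters because distinct
  \<open>a\<close> may give the same map \<open>a . \<Delta>\<close>.\<close>

lemma module_linear_image:
  fixes R :: "('r, 'k) ring_scheme" and M :: "('r, 'a, 'm) module_scheme"
    and N :: "('r, 'b, 'n) module_scheme"
  assumes "module R M"
    and carrier_N: "carrier N = f ` carrier M"
    and add: "\<And>x y. \<lbrakk>x \<in> carrier M; y \<in> carrier M\<rbrakk> \<Longrightarrow> f (x \<oplus>\<^bsub>M\<^esub> y) = f x \<oplus>\<^bsub>N\<^esub> f y"
    and smult: "\<And>r x. \<lbrakk>r \<in> carrier R; x \<in> carrier M\<rbrakk> \<Longrightarrow> f (r \<odot>\<^bsub>M\<^esub> x) = r \<odot>\<^bsub>N\<^esub> f x"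
    and zero: "f \<zero>\<^bsub>M\<^esub> = \<zero>\<^bsub>N\<^esub>"
  shows "module R N"
proof -
  interpret M: module R M by fact
  have "abelian_group N"
  proof (rule abelian_groupI)
    show "\<exists>y\<in>carrier N. y \<oplus>\<^bsub>N\<^esub> x = \<zero>\<^bsub>N\<^esub>" if "x \<in> carrier N" for x
    proof -
      from that obtain a where a: "a \<in> carrier M" "x = f a"
        by (auto simp: carrier_N)
      have "f (\<ominus>\<^bsub>M\<^esub> a) \<oplus>\<^bsub>N\<^esub> x = \<zero>\<^bsub>N\<^esub>"
        using a by (simp flip: add zero add: M.l_neg)
      with a show ?thesis by (auto simp: carrier_N)
    qed
  qed (auto simp: carrier_N M.add.m_ac simp flip: add zero)
  with M.cring_axioms show ?thesis
    by (rule module.intro)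
      (unfold_locales, auto simp: carrier_N M.smult_l_distr M.smult_r_distr M.smult_assoc1
        simp flip: add smult)
qed

context cring
begin

text \<open>Removes the common term that the second Leibniz expansion of
  \<open>\<Delta> (br x y)\<close> produces in both halves of the difference.\<close>

lemma a_diff_cancel_right:
  assumes "p \<in> carrier R" "x \<in> carrier R" "y \<in> carrier R"
  shows "x \<oplus> p \<ominus> (y \<oplus> p) = x \<ominus> y"
proof -
  have "x \<oplus> p \<ominus> (y \<oplus> p) = x \<oplus> (p \<oplus> (\<ominus> p \<oplus> \<ominus> y))"
    using assms by (simp add: minus_eq minus_add a_assoc a_comm[of y p])
  also have "\<dots> = x \<ominus> y"
    using assms by (simp add: minus_eq r_neg2)
  finally show ?thesis .
qed

text \<open>Collecting positive and negative parts separately turns a cancellation problem into an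
  equality of two sums, which rewriting modulo associativity and commutativity can decide.\<close>

lemma sum_of_differences_zero:
  assumes "p \<in> carrier R" "q \<in> carrier R" "r \<in> carrier R"
    and "p' \<in> carrier R" "q' \<in> carrier R" "r' \<in> carrier R"
    and "p \<oplus> q \<oplus> r = p' \<oplus> q' \<oplus> r'"
  shows "(p \<ominus> p') \<oplus> (q \<ominus> q') \<oplus> (r \<ominus> r') = \<zero>"
proof -
  have "(p \<ominus> p') \<oplus> (q \<ominus> q') \<oplus> (r \<ominus> r') = (p \<oplus> q \<oplus> r) \<oplus> \<ominus> (p' \<oplus> q' \<oplus> r')"
    using assms(1-6) by (simp add: minus_eq minus_add a_ac)
  also have "\<dots> = \<zero>"
    using assms by (simp add: r_neg)
  finally show ?thesis .
qed

text \<open>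
  Below, \<open>a\<close>, \<open>u\<close>, \<open>sa\<close>, \<open>ta\<close>, \<open>da\<close> are instantiated with \<open>\<sigma> (\<sigma> x)\<close>, \<open>\<tau> (\<sigma> x)\<close>, \<open>\<sigma> (\<Delta> x)\<close>,
  \<open>\<tau> (\<Delta> x)\<close>, \<open>\<Delta> (\<Delta> x)\<close>, the families \<open>b, v, \<dots>\<close> and \<open>c, w, \<dots>\<close> with the same terms in \<open>y\<close> and
  \<open>z\<close>, and \<open>d\<close> with \<open>\<delta>\<close>.
\<close>
lemma cyclic_sum_zero:
  assumes "a \<in> carrier R" "b \<in> carrier R" "c \<in> carrier R"
    "u \<in> carrier R" "v \<in> carrier R" "w \<in> carrier R"
    "sa \<in> carrier R" "sb \<in> carrier R" "sc \<in> carrier R"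
    "ta \<in> carrier R" "tb \<in> carrier R" "tc \<in> carrier R"
    "da \<in> carrier R" "db \<in> carrier R" "dc \<in> carrier R"
    "d \<in> carrier R"
  shows "(a \<otimes> (d \<otimes> (sb \<otimes> tc \<ominus> sc \<otimes> tb) \<oplus> (b \<otimes> dc \<ominus> c \<otimes> db)) \<oplus> u \<otimes> (v \<otimes> dc \<ominus> w \<otimes> db)
        \<ominus> (b \<otimes> sc \<ominus> c \<otimes> sb) \<otimes> (d \<otimes> sa \<oplus> d \<otimes> ta))
      \<oplus> (b \<otimes> (d \<otimes> (sc \<otimes> ta \<ominus> sa \<otimes> tc) \<oplus> (c \<otimes> da \<ominus> a \<otimes> dc)) \<oplus> v \<otimes> (w \<otimes> da \<ominus> u \<otimes> dc)
        \<ominus> (c \<otimes> sa \<ominus> a \<otimes> sc) \<otimes> (d \<otimes> sb \<oplus> d \<otimes> tb))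
      \<oplus> (c \<otimes> (d \<otimes> (sa \<otimes> tb \<ominus> sb \<otimes> ta) \<oplus> (a \<otimes> db \<ominus> b \<otimes> da)) \<oplus> w \<otimes> (u \<otimes> db \<ominus> v \<otimes> da)
        \<ominus> (a \<otimes> sb \<ominus> b \<otimes> sa) \<otimes> (d \<otimes> sc \<oplus> d \<otimes> tc)) = \<zero>"
proof -
  \<comment> \<open>Each cyclic summand becomes five positive monomials minus five negative ones.
    Over the whole cyclic sum the fifteen positive monomials are a rearrangement of the fifteen
    negative ones.\<close>
  have expand: "x \<otimes> (d \<otimes> (sy \<otimes> tz \<ominus> sz \<otimes> ty) \<oplus> (y \<otimes> dz \<ominus> z \<otimes> dy)) \<oplus> k \<otimes> (l \<otimes> dz \<ominus> m \<otimes> dy)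
        \<ominus> (y \<otimes> sz \<ominus> z \<otimes> sy) \<otimes> (d \<otimes> sx \<oplus> d \<otimes> tx)
      = (x \<otimes> d \<otimes> sy \<otimes> tz \<oplus> x \<otimes> y \<otimes> dz \<oplus> k \<otimes> l \<otimes> dz \<oplus> z \<otimes> sy \<otimes> d \<otimes> sx \<oplus> z \<otimes> sy \<otimes> d \<otimes> tx)
        \<ominus> (x \<otimes> d \<otimes> sz \<otimes> ty \<oplus> x \<otimes> z \<otimes> dy \<oplus> k \<otimes> m \<otimes> dy \<oplus> y \<otimes> sz \<otimes> d \<otimes> sx \<oplus> y \<otimes> sz \<otimes> d \<otimes> tx)"
    if "x \<in> carrier R" "y \<in> carrier R" "z \<in> carrier R"
      "k \<in> carrier R" "l \<in> carrier R" "m \<in> carrier R"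
      "sx \<in> carrier R" "sy \<in> carrier R" "sz \<in> carrier R"
      "tx \<in> carrier R" "ty \<in> carrier R" "tz \<in> carrier R"
      "dy \<in> carrier R" "dz \<in> carrier R"
    for x y z k l m sx sy sz tx ty tz dy dz
    using that \<open>d \<in> carrier R\<close>
    by (simp add: minus_eq minus_add l_distr r_distr l_minus r_minus a_ac m_assoc)
  show ?thesis
    by (simp only: expand assms)
      (rule sum_of_differences_zero; use assms in \<open>simp add: a_ac m_ac\<close>)
qed

end

theorem theorem2p6:
  fixes R :: "('r, 'k) ring_scheme" and A :: "('r, 'a, 'm) module_scheme"
    and \<sigma> \<tau> \<Delta> :: "'a \<Rightarrow> 'a" and \<delta> :: 'a
    and bracket :: "('a \<Rightarrow> 'a) \<Rightarrow> ('a \<Rightarrow> 'a) \<Rightarrow> ('a \<Rightarrow> 'a)"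
    and twist :: "('a \<Rightarrow> 'a) \<Rightarrow> ('a \<Rightarrow> 'a)"
  assumes "algebra R A"
    and "algebra_morphism R A A \<sigma>"
    and "algebra_morphism R A A \<tau>"
    and "twisted_derivation R A \<tau> \<sigma> \<Delta>"
    and "\<delta> \<in> carrier A"
    and "\<And>a. a \<in> carrier A \<Longrightarrow> \<sigma> (\<tau> a) = \<tau> (\<sigma> a)"
    and "\<And>a. a \<in> carrier A \<Longrightarrow> \<Delta> (\<sigma> a) = \<delta> \<otimes>\<^bsub>A\<^esub> \<sigma> (\<Delta> a)"
    and "\<And>a. a \<in> carrier A \<Longrightarrow> \<Delta> (\<tau> a) = \<delta> \<otimes>\<^bsub>A\<^esub> \<tau> (\<Delta> a)"
    and bracket_def: "\<And>a b. \<lbrakk>a \<in> carrier A; b \<in> carrier A\<rbrakk> \<Longrightarrow>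
      bracket (left_mult_map A \<Delta> a) (left_mult_map A \<Delta> b) =
        left_mult_map A \<Delta> (\<sigma> a \<otimes>\<^bsub>A\<^esub> \<Delta> b \<ominus>\<^bsub>A\<^esub> \<sigma> b \<otimes>\<^bsub>A\<^esub> \<Delta> a)"
    and twist_def: "\<And>a. a \<in> carrier A \<Longrightarrow>
      twist (left_mult_map A \<Delta> a) = left_mult_map A \<Delta> (\<sigma> a \<oplus>\<^bsub>A\<^esub> \<tau> a)"
  shows "hom_lie_algebra R (left_mult_module A \<Delta>) bracket twist"
proof -
  interpret A: cring A
    by (rule algebra.M_cring) fact
  interpret Alg: algebra R A by fact
  let ?L = "left_mult_module A \<Delta>" and ?f = "left_mult_map A \<Delta>"
  note comm = assms(6) and delta = assms(7,8) and [simp] = \<open>\<delta> \<in> carrier A\<close>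
  have carrier [simp]: "\<sigma> a \<in> carrier A" "\<tau> a \<in> carrier A" "\<Delta> a \<in> carrier A"
    if "a \<in> carrier A" for a
    using assms(2-4) that
    by (auto simp: algebra_morphism_def twisted_derivation_def linear_map_def)
  have add: "\<sigma> (a \<oplus>\<^bsub>A\<^esub> b) = \<sigma> a \<oplus>\<^bsub>A\<^esub> \<sigma> b" "\<tau> (a \<oplus>\<^bsub>A\<^esub> b) = \<tau> a \<oplus>\<^bsub>A\<^esub> \<tau> b"
      "\<Delta> (a \<oplus>\<^bsub>A\<^esub> b) = \<Delta> a \<oplus>\<^bsub>A\<^esub> \<Delta> b"
    if "a \<in> carrier A" "b \<in> carrier A" for a b
    using assms(2-4) that
    by (auto simp: algebra_morphism_def twisted_derivation_def linear_map_def)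
  have smult: "\<sigma> (r \<odot>\<^bsub>A\<^esub> a) = r \<odot>\<^bsub>A\<^esub> \<sigma> a" "\<tau> (r \<odot>\<^bsub>A\<^esub> a) = r \<odot>\<^bsub>A\<^esub> \<tau> a"
      "\<Delta> (r \<odot>\<^bsub>A\<^esub> a) = r \<odot>\<^bsub>A\<^esub> \<Delta> a"
    if "r \<in> carrier R" "a \<in> carrier A" for r a
    using assms(2-4) that
    by (auto simp: algebra_morphism_def twisted_derivation_def linear_map_def)
  have mult: "\<sigma> (a \<otimes>\<^bsub>A\<^esub> b) = \<sigma> a \<otimes>\<^bsub>A\<^esub> \<sigma> b" "\<tau> (a \<otimes>\<^bsub>A\<^esub> b) = \<tau> a \<otimes>\<^bsub>A\<^esub> \<tau> b"
      and leibniz: "\<Delta> (a \<otimes>\<^bsub>A\<^esub> b) = \<Delta> a \<otimes>\<^bsub>A\<^esub> \<tau> b \<oplus>\<^bsub>A\<^esub> \<sigma> a \<otimes>\<^bsub>A\<^esub> \<Delta> b"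
    if "a \<in> carrier A" "b \<in> carrier A" for a b
    using assms(2-4) that
    by (auto simp: algebra_morphism_def twisted_derivation_def ring_hom_def)
  \<comment> \<open>Stated for any additive self-map, so that it covers both the ring morphism
    \<sigma> and the twisted derivation \<Delta>, which in general is not multiplicative.\<close>
  have additive_diff: "h (a \<ominus>\<^bsub>A\<^esub> b) = h a \<ominus>\<^bsub>A\<^esub> h b"
    if h: "\<And>a. a \<in> carrier A \<Longrightarrow> h a \<in> carrier A"
      "\<And>a b. \<lbrakk>a \<in> carrier A; b \<in> carrier A\<rbrakk> \<Longrightarrow> h (a \<oplus>\<^bsub>A\<^esub> b) = h a \<oplus>\<^bsub>A\<^esub> h b"
      and a: "a \<in> carrier A" and b: "b \<in> carrier A" for h a b
  proof -
    have "a \<ominus>\<^bsub>A\<^esub> b \<oplus>\<^bsub>A\<^esub> b = a"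
      using a b by (simp add: A.minus_eq A.a_assoc A.l_neg)
    then have "h a = h (a \<ominus>\<^bsub>A\<^esub> b) \<oplus>\<^bsub>A\<^esub> h b"
      using h(2)[of "a \<ominus>\<^bsub>A\<^esub> b" b] a b by simp
    moreover have "h (a \<ominus>\<^bsub>A\<^esub> b) \<in> carrier A" "h b \<in> carrier A"
      using a b by (auto intro!: h)
    ultimately show ?thesis by (simp add: A.minus_eq A.a_assoc A.r_neg)
  qed
  have diff: "\<sigma> (a \<ominus>\<^bsub>A\<^esub> b) = \<sigma> a \<ominus>\<^bsub>A\<^esub> \<sigma> b" "\<Delta> (a \<ominus>\<^bsub>A\<^esub> b) = \<Delta> a \<ominus>\<^bsub>A\<^esub> \<Delta> b"
    if "a \<in> carrier A" "b \<in> carrier A" for a b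
    using that by (auto intro!: additive_diff simp: add)

  \<comment> \<open>Linearity of the surjection \<open>?f\<close> lets the module structure and all
    linear identities descend from \<open>A\<close> to \<open>?L\<close>. Both sides are restricted
    to \<open>carrier A\<close>, so pointwise equality there suffices.\<close>
  have f_add: "?f (a \<oplus>\<^bsub>A\<^esub> b) = ?f a \<oplus>\<^bsub>?L\<^esub> ?f b"
    if "a \<in> carrier A" "b \<in> carrier A" for a b
    using that by (auto simp: left_mult_module_def maps_module_def left_mult_map_def
        restrict_def A.l_distr)
  have f_smult: "?f (r \<odot>\<^bsub>A\<^esub> a) = r \<odot>\<^bsub>?L\<^esub> ?f a"
    if "r \<in> carrier R" "a \<in> carrier A" for r a
    using that by (auto simp: left_mult_module_def maps_module_def left_mult_map_def
        restrict_def Alg.smult_assoc2)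
  have f_zero: "?f \<zero>\<^bsub>A\<^esub> = \<zero>\<^bsub>?L\<^esub>"
    by (auto simp: left_mult_module_def maps_module_def left_mult_map_def)
  have carrier_L: "carrier ?L = ?f ` carrier A"
    by (simp add: left_mult_module_def)
  have "module R ?L"
    by (rule module_linear_image[OF Alg.module_axioms carrier_L f_add f_smult f_zero])
  then interpret L: module R ?L .

  define br where "br a b = \<sigma> a \<otimes>\<^bsub>A\<^esub> \<Delta> b \<ominus>\<^bsub>A\<^esub> \<sigma> b \<otimes>\<^bsub>A\<^esub> \<Delta> a" for a b
  \<comment> \<open>The hypothesis on \<open>bracket\<close> holds for every choice of
    representatives, so values may be computed by \<open>br\<close> from any of them.\<close>
  have bracket: "bracket (?f a) (?f b) = ?f (br a b)" if "a \<in> carrier A" "b \<in> carrier A" for a b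
    using that by (simp add: bracket_def br_def)
  have br_carrier [simp]: "br a b \<in> carrier A" if "a \<in> carrier A" "b \<in> carrier A" for a b
    using that by (simp add: br_def)
  have br_add: "br (a \<oplus>\<^bsub>A\<^esub> b) c = br a c \<oplus>\<^bsub>A\<^esub> br b c" "br c (a \<oplus>\<^bsub>A\<^esub> b) = br c a \<oplus>\<^bsub>A\<^esub> br c b"
    if [simp]: "a \<in> carrier A" "b \<in> carrier A" "c \<in> carrier A" for a b c
    by (simp_all add: br_def add A.minus_eq A.l_distr A.r_distr A.minus_add A.a_ac)
  have mult_smult: "a \<otimes>\<^bsub>A\<^esub> (r \<odot>\<^bsub>A\<^esub> b) = r \<odot>\<^bsub>A\<^esub> (a \<otimes>\<^bsub>A\<^esub> b)"
    if "r \<in> carrier R" "a \<in> carrier A" "b \<in> carrier A" for r a b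
    using Alg.smult_assoc2[of r b a] that by (simp add: A.m_comm)
  have br_smult: "br (r \<odot>\<^bsub>A\<^esub> a) b = r \<odot>\<^bsub>A\<^esub> br a b" "br b (r \<odot>\<^bsub>A\<^esub> a) = r \<odot>\<^bsub>A\<^esub> br b a"
    if [simp]: "r \<in> carrier R" "a \<in> carrier A" "b \<in> carrier A" for r a b
    by (simp_all add: br_def smult Alg.smult_assoc2 mult_smult A.minus_eq
        Alg.smult_r_distr Alg.smult_r_minus)
  have jacobi: "br (\<sigma> a \<oplus>\<^bsub>A\<^esub> \<tau> a) (br b c) \<oplus>\<^bsub>A\<^esub> br (\<sigma> b \<oplus>\<^bsub>A\<^esub> \<tau> b) (br c a)
      \<oplus>\<^bsub>A\<^esub> br (\<sigma> c \<oplus>\<^bsub>A\<^esub> \<tau> c) (br a b) = \<zero>\<^bsub>A\<^esub>"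
    if [simp]: "a \<in> carrier A" "b \<in> carrier A" "c \<in> carrier A" for a b c
  proof -
    have \<Delta>_br: "\<Delta> (br x y) = \<delta> \<otimes>\<^bsub>A\<^esub> (\<sigma> (\<Delta> x) \<otimes>\<^bsub>A\<^esub> \<tau> (\<Delta> y) \<ominus>\<^bsub>A\<^esub> \<sigma> (\<Delta> y) \<otimes>\<^bsub>A\<^esub> \<tau> (\<Delta> x))
        \<oplus>\<^bsub>A\<^esub> (\<sigma> (\<sigma> x) \<otimes>\<^bsub>A\<^esub> \<Delta> (\<Delta> y) \<ominus>\<^bsub>A\<^esub> \<sigma> (\<sigma> y) \<otimes>\<^bsub>A\<^esub> \<Delta> (\<Delta> x))" (is "_ = ?u")
      and \<Delta>_br': "\<Delta> (br x y) = \<tau> (\<sigma> x) \<otimes>\<^bsub>A\<^esub> \<Delta> (\<Delta> y) \<ominus>\<^bsub>A\<^esub> \<tau> (\<sigma> y) \<otimes>\<^bsub>A\<^esub> \<Delta> (\<Delta> x)" (is "_ = ?v")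
      if [simp]: "x \<in> carrier A" "y \<in> carrier A" for x y
    proof -
      show "\<Delta> (br x y) = ?u"
        unfolding br_def
        by (simp add: diff leibniz delta)
          (simp add: A.minus_eq A.r_distr A.minus_add A.r_minus A.a_ac A.m_assoc)
      \<comment> \<open>With the factors swapped, the Leibniz rule gives the extra term
        \<open>\<sigma> (\<Delta> y)\<close> times \<delta> times
        \<open>\<sigma> (\<Delta> x)\<close>. It is symmetric in \<open>x\<close> and
        \<open>y\<close> and drops out of the difference.\<close>
      have "br x y = \<Delta> y \<otimes>\<^bsub>A\<^esub> \<sigma> x \<ominus>\<^bsub>A\<^esub> \<Delta> x \<otimes>\<^bsub>A\<^esub> \<sigma> y"
        by (simp add: br_def A.m_comm)
      then show "\<Delta> (br x y) = ?v"
        by (simp add: diff leibniz delta A.m_ac A.a_diff_cancel_right)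
    qed
    \<comment> \<open>Matching the expansions to the outer factors gives
      \<open>\<Delta> (\<Delta> z)\<close> the coefficients \<open>\<sigma> (\<sigma> x)\<close>
      times \<open>\<sigma> (\<sigma> y)\<close> and \<open>\<tau> (\<sigma> x)\<close> times
      \<open>\<tau> (\<sigma> y)\<close>. Both are symmetric in \<open>x\<close> and
      \<open>y\<close>, which makes the second-order terms cancel cyclically; a mixed product would
      find no partner.\<close>
    have "br (\<sigma> x \<oplus>\<^bsub>A\<^esub> \<tau> x) (br y z) =
        \<sigma> (\<sigma> x) \<otimes>\<^bsub>A\<^esub> (\<delta> \<otimes>\<^bsub>A\<^esub> (\<sigma> (\<Delta> y) \<otimes>\<^bsub>A\<^esub> \<tau> (\<Delta> z) \<ominus>\<^bsub>A\<^esub> \<sigma> (\<Delta> z) \<otimes>\<^bsub>A\<^esub> \<tau> (\<Delta> y))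
          \<oplus>\<^bsub>A\<^esub> (\<sigma> (\<sigma> y) \<otimes>\<^bsub>A\<^esub> \<Delta> (\<Delta> z) \<ominus>\<^bsub>A\<^esub> \<sigma> (\<sigma> z) \<otimes>\<^bsub>A\<^esub> \<Delta> (\<Delta> y)))
        \<oplus>\<^bsub>A\<^esub> \<tau> (\<sigma> x) \<otimes>\<^bsub>A\<^esub> (\<tau> (\<sigma> y) \<otimes>\<^bsub>A\<^esub> \<Delta> (\<Delta> z) \<ominus>\<^bsub>A\<^esub> \<tau> (\<sigma> z) \<otimes>\<^bsub>A\<^esub> \<Delta> (\<Delta> y))
        \<ominus>\<^bsub>A\<^esub> (\<sigma> (\<sigma> y) \<otimes>\<^bsub>A\<^esub> \<sigma> (\<Delta> z) \<ominus>\<^bsub>A\<^esub> \<sigma> (\<sigma> z) \<otimes>\<^bsub>A\<^esub> \<sigma> (\<Delta> y))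
          \<otimes>\<^bsub>A\<^esub> (\<delta> \<otimes>\<^bsub>A\<^esub> \<sigma> (\<Delta> x) \<oplus>\<^bsub>A\<^esub> \<delta> \<otimes>\<^bsub>A\<^esub> \<tau> (\<Delta> x))"
      if [simp]: "x \<in> carrier A" "y \<in> carrier A" "z \<in> carrier A" for x y z
    proof -
      have "br (\<sigma> x \<oplus>\<^bsub>A\<^esub> \<tau> x) (br y z) =
          \<sigma> (\<sigma> x) \<otimes>\<^bsub>A\<^esub> \<Delta> (br y z) \<oplus>\<^bsub>A\<^esub> \<tau> (\<sigma> x) \<otimes>\<^bsub>A\<^esub> \<Delta> (br y z)
          \<ominus>\<^bsub>A\<^esub> \<sigma> (br y z) \<otimes>\<^bsub>A\<^esub> (\<delta> \<otimes>\<^bsub>A\<^esub> \<sigma> (\<Delta> x) \<oplus>\<^bsub>A\<^esub> \<delta> \<otimes>\<^bsub>A\<^esub> \<tau> (\<Delta> x))"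
        by (simp add: br_def[of "\<sigma> x \<oplus>\<^bsub>A\<^esub> \<tau> x"] add comm delta A.l_distr)
      moreover have "\<sigma> (br y z) = \<sigma> (\<sigma> y) \<otimes>\<^bsub>A\<^esub> \<sigma> (\<Delta> z) \<ominus>\<^bsub>A\<^esub> \<sigma> (\<sigma> z) \<otimes>\<^bsub>A\<^esub> \<sigma> (\<Delta> y)"
        by (simp add: br_def diff mult)
      \<comment> \<open>Both expansions are supplied: the goal has the first beside
        \<open>\<sigma> (\<sigma> x)\<close> and the second beside
        \<open>\<tau> (\<sigma> x)\<close>.\<close>
      ultimately show ?thesis
        using \<Delta>_br[of y z] \<Delta>_br'[of y z] by simp
    qed
    then show ?thesis
      by (simp only: that) (rule A.cyclic_sum_zero; simp)
  qed

  show ?thesis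
  proof
    fix x y z
    assume "x \<in> carrier ?L" "y \<in> carrier ?L"
    then obtain a b where [simp]: "a \<in> carrier A" "x = ?f a" "b \<in> carrier A" "y = ?f b"
      by (auto simp: carrier_L)
    \<comment> \<open>Skew-symmetry is phrased as a vanishing sum because \<open>f_add\<close> and
      \<open>f_zero\<close> carry sums and zero to \<open>?L\<close>; uniqueness of negatives there
      then gives the required form.\<close>
    have "br a b \<oplus>\<^bsub>A\<^esub> br b a = \<zero>\<^bsub>A\<^esub>"
      by (simp add: br_def A.minus_eq A.a_assoc A.r_neg A.r_neg1 A.r_neg2)
    then have "bracket x y \<oplus>\<^bsub>?L\<^esub> bracket y x = \<zero>\<^bsub>?L\<^esub>"
      by (simp add: bracket f_zero flip: f_add)
    then show "bracket x y = \<ominus>\<^bsub>?L\<^esub> bracket y x"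
      by (intro L.minus_equality[symmetric]) (auto simp: carrier_L bracket)
    assume "z \<in> carrier ?L"
    then obtain c where [simp]: "c \<in> carrier A" "z = ?f c"
      by (auto simp: carrier_L)
    show "bracket (twist x) (bracket y z) \<oplus>\<^bsub>?L\<^esub> bracket (twist y) (bracket z x)
          \<oplus>\<^bsub>?L\<^esub> bracket (twist z) (bracket x y) = \<zero>\<^bsub>?L\<^esub>"
      by (simp add: bracket twist_def f_zero jacobi flip: f_add)
  next
    show "linear_map R ?L ?L twist"
      by (auto simp: linear_map_def carrier_L twist_def add smult Alg.smult_r_distr A.add.m_ac
          simp flip: f_add f_smult)
  qed (auto simp: linear_map_def carrier_L bracket br_add br_smult simp flip: f_add f_smult)
qed

end
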